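(* Consider the F-RAN system described in the context, with $n_T$ antennas at each EN, fractional cache size $\mu\in[0,1]$ and fronthaul rate $r\ge0$. The minimum NDT (serial fronthaul-edge transmission) satisfies $\delta^*(\mu,r)\ge\delta_{lb}(\mu,r)$, where $$\delta_{lb}(\mu,r)=\begin{cases}\max\Big\{\dfrac{K_R(m^*(r)-\mu K_T)}{K_Tr}+\dfrac{K_R}{m^*(r)n_T},\,1\Big\}, & \mu K_T<m^*(r),\\[2ex] \max\Big\{\dfrac{K_R}{\mu K_Tn_T},\,1\Big\}, & \mu K_T\ge m^*(r),\end{cases}$$ with $$m^*(r)=\begin{cases}\max\big\{\sqrt{K_Tr/n_T},\,1\big\}, & r<r_{th},\\ m_{max}, & r\ge r_{th},\end{cases}\qquad r_{th}=\frac{n_T}{K_T}m_{max}^2,\qquad m_{max}=\min\{K_T,\lceil K_R/n_T\rceil\}.$$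
   Context: F-RAN model. $K_T,K_R,n_T\ge 1$ and $N\ge K_R$ are integers; $[K]=\{1,\dots,K\}$. There are $K_T$ edge nodes (ENs) with $n_T$ antennas each, $K_R$ single-antenna users, and a cloud with a library of $N$ files $W_1,\dots,W_N$ of equal size. Each file is split into $F\ge 1$ equal packets, $\mathcal W_n=\{W_{n1},\dots,W_{nF}\}$ ($F$ is a free design parameter). $\mu\in[0,1]$ is the fractional cache size and $r\ge 0$ the fronthaul rate (each fronthaul link has capacity $r\log P$ bits per channel use, $P$ = SNR). Caching: EN $i$ stores sets $\mathcal C_{in}\subseteq\mathcal W_n$ with $|\mathcal C_{in}|\le \mu F$ for every $n$, chosen before the requests are known; $\mathcal C_i=\bigcup_n\mathcal C_{in}$. Delivery: user $k$ requests file $d_k\in[N]$; $\boldsymbol d=(d_1,\dots,d_{K_R})$. The cloud sends to EN $i$ a set $\mathcal F_i$ of (uncoded) packets of requested files. Then edge transmission takes place in $B$ blocks by one-shot linear precoding: in each block $b$ a set $\mathcal R(b)\subseteq[K_R]$ of users is served, each $k\in\mathcal R(b)$ with exactly one packet of $W_{d_k}$; the stream for user $k$ is sent with precoding vectors $\boldsymbol v_{i,k}\in\mathbb C^{n_T}$ by those ENs $i$ whose set $\mathcal C_i\cup\mathcal F_i$ contains that packet (the other ENs use $\boldsymbol v_{i,k}=0$); decodability without interference means $\sum_i \boldsymbol h_{ki}^T\boldsymbol v_{i,k}\ne 0$ and $\sum_i \boldsymbol h_{k'i}^T\boldsymbol v_{i,k}=0$ for all $k'\in\mathcal R(b)\setminus\{k\}$,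 where $\boldsymbol h_{ki}=\boldsymbol h_{ki}(b)\in\mathbb C^{n_T}$ is the channel from EN $i$ to user $k$. After the $B$ blocks every user must have received all $F$ packets of its file. The fronthaul sets and the edge transmission may depend on $\boldsymbol d$ and on the channels. The channels are arbitrary but non-degenerate: in each block, every square submatrix of the $K_R\times K_Tn_T$ matrix with rows $(\boldsymbol h_{k1}^T,\dots,\boldsymbol h_{kK_T}^T)$ is invertible. NDT (serial mode): for a policy and request $\boldsymbol d$, the fronthaul NDT is $\max_i|\mathcal F_i|/(Fr)$ (if $r=0$, nothing may be sent on the fronthaul and this is $0$), the edge NDT is $B/F$, and the NDT of the policy is the maximum over $\boldsymbol d$ of their sum. $\bar\delta(\mu,r)$ is the infimum of the NDT over all $F\ge1$ and all policies ($+\infty$ if there is none), and the minimum NDT $\delta^*(\mu,r)$ is the lower convex envelope of $\bar\delta(\mu,r)$ as a function of $\mu\in[0,1]$ for fixed $r$. For $r=0$, a quotient with positive numerator and denominator $K_Tr$ is $+\infty$. *)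

theory Defs
  imports
    "HOL-Analysis.Convex"
    "HOL-Analysis.Product_Vector"
    "HOL-Library.Extended_Real"
    "HOL-Library.FuncSet"
    "Jordan_Normal_Form.Matrix"
    "Jordan_Normal_Form.DL_Submatrix"
begin

text \<open>
  All index sets are counted from 0: edge nodes \<open>i < KT\<close>, users \<open>k < KR\<close>, files \<open>n < N\<close>,
  blocks \<open>b < B\<close>, antennas \<open>a < nT\<close>.  The pair \<open>(n, f)\<close> with \<open>f < F\<close> is packet \<open>f\<close> of file \<open>n\<close>.
\<close>

type_synonym packet = "nat \<times> nat"

definition file_packets :: "nat \<Rightarrow> nat \<Rightarrow> packet set" where
  "file_packets F n = {n} \<times> {..<F}"


text \<open>
  \<open>h b k i\<close> is the channel vector from edge node \<open>i\<close> to user \<open>k\<close> in block \<open>b\<close>.  The sequence of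
  blocks is infinite because the number of blocks used is chosen by the policy.
  Row \<open>k\<close> of \<open>channel_mat\<close> is the concatenation of \<open>h b k 0, \<dots>, h b k (KT - 1)\<close>.
\<close>

type_synonym channel = "nat \<Rightarrow> nat \<Rightarrow> nat \<Rightarrow> complex vec"

definition channel_mat :: "nat \<Rightarrow> nat \<Rightarrow> nat \<Rightarrow> channel \<Rightarrow> nat \<Rightarrow> complex mat" where
  "channel_mat KT KR nT h b = mat KR (KT * nT) (\<lambda>(k, c). vec_index (h b k (c div nT)) (c mod nT))"

definition nondegenerate_channel :: "nat \<Rightarrow> nat \<Rightarrow> nat \<Rightarrow> channel \<Rightarrow> bool" where
  "nondegenerate_channel KT KR nT h \<longleftrightarrow>
     (\<forall>b. \<forall>k<KR. \<forall>i<KT. h b k i \<in> carrier_vec nT) \<and>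
     (\<forall>b I J. I \<subseteq> {..<KR} \<longrightarrow> J \<subseteq> {..<KT * nT} \<longrightarrow> card I = card J \<longrightarrow>
        invertible_mat (submatrix (channel_mat KT KR nT h b) I J))"


text \<open>
  \<open>cache i n\<close> is the set of packets of file \<open>n\<close> stored at edge node \<open>i\<close>.
\<close>

definition valid_cache ::
  "nat \<Rightarrow> nat \<Rightarrow> real \<Rightarrow> nat \<Rightarrow> (nat \<Rightarrow> nat \<Rightarrow> packet set) \<Rightarrow> bool" where
  "valid_cache KT N \<mu> F cache \<longleftrightarrow>
     (\<forall>i<KT. \<forall>n<N. cache i n \<subseteq> file_packets F n \<and> real (card (cache i n)) \<le> \<mu> * real F)"

text \<open>
  Delivery for one request: \<open>fronthaul i\<close> is the set of packets sent by the cloud to edge node \<open>i\<close>,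
  \<open>num_blocks\<close> the number of blocks, \<open>served b\<close> the set of users served in block \<open>b\<close>,
  \<open>sent_packet b k\<close> the packet sent to user \<open>k\<close> in block \<open>b\<close>, and \<open>precoder b i k\<close> the precoding
  vector of edge node \<open>i\<close> for the stream of user \<open>k\<close> in block \<open>b\<close>.
\<close>

record delivery =
  fronthaul :: "nat \<Rightarrow> packet set"
  num_blocks :: nat
  served :: "nat \<Rightarrow> nat set"
  sent_packet :: "nat \<Rightarrow> nat \<Rightarrow> packet"
  precoder :: "nat \<Rightarrow> nat \<Rightarrow> nat \<Rightarrow> complex vec"

definition available ::
  "nat \<Rightarrow> (nat \<Rightarrow> nat \<Rightarrow> packet set) \<Rightarrow> delivery \<Rightarrow> nat \<Rightarrow> packet set" where
  "available N cache D i = (\<Union>n<N. cache i n) \<union> fronthaul D i"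

text \<open>The gain with which the stream of user \<open>k\<close> is received at user \<open>k'\<close> in block \<open>b\<close>
  (\<open>scalar_prod\<close> is bilinear, without complex conjugation).\<close>

definition stream_gain :: "nat \<Rightarrow> channel \<Rightarrow> delivery \<Rightarrow> nat \<Rightarrow> nat \<Rightarrow> nat \<Rightarrow> complex" where
  "stream_gain KT h D b k' k = (\<Sum>i<KT. scalar_prod (h b k' i) (precoder D b i k))"

definition valid_block ::
  "nat \<Rightarrow> nat \<Rightarrow> nat \<Rightarrow> nat \<Rightarrow> channel \<Rightarrow> nat \<Rightarrow> (nat \<Rightarrow> nat \<Rightarrow> packet set) \<Rightarrow> (nat \<Rightarrow> nat)
     \<Rightarrow> delivery \<Rightarrow> nat \<Rightarrow> bool" where
  "valid_block KT KR nT N h F cache d D b \<longleftrightarrow>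
     served D b \<subseteq> {..<KR} \<and>
     (\<forall>k\<in>served D b.
        sent_packet D b k \<in> file_packets F (d k) \<and>
        (\<forall>i<KT. precoder D b i k \<in> carrier_vec nT) \<and>
        (\<forall>i<KT. sent_packet D b k \<notin> available N cache D i \<longrightarrow> precoder D b i k = 0\<^sub>v nT) \<and>
        stream_gain KT h D b k k \<noteq> 0 \<and>
        (\<forall>k'\<in>served D b - {k}. stream_gain KT h D b k' k = 0))"

definition valid_delivery ::
  "nat \<Rightarrow> nat \<Rightarrow> nat \<Rightarrow> nat \<Rightarrow> real \<Rightarrow> channel \<Rightarrow> nat \<Rightarrow> (nat \<Rightarrow> nat \<Rightarrow> packet set)
     \<Rightarrow> (nat \<Rightarrow> nat) \<Rightarrow> delivery \<Rightarrow> bool" where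
  "valid_delivery KT KR nT N r h F cache d D \<longleftrightarrow>
     (\<forall>i<KT. fronthaul D i \<subseteq> (\<Union>k<KR. file_packets F (d k))) \<and>
     (r = 0 \<longrightarrow> (\<forall>i<KT. fronthaul D i = {})) \<and>
     (\<forall>b<num_blocks D. valid_block KT KR nT N h F cache d D b) \<and>
     (\<forall>k<KR. \<forall>p\<in>file_packets F (d k).
        \<exists>b<num_blocks D. k \<in> served D b \<and> sent_packet D b k = p)"

definition requests :: "nat \<Rightarrow> nat \<Rightarrow> (nat \<Rightarrow> nat) set" where
  "requests KR N = {..<KR} \<rightarrow>\<^sub>E {..<N}"

text \<open>
  A policy consists of a cache placement, which does not depend on the request, and one delivery
  for each request.  The channel \<open>h\<close> is a fixed parameter, so the delivery may depend on it.
\<close>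

definition valid_policy ::
  "nat \<Rightarrow> nat \<Rightarrow> nat \<Rightarrow> nat \<Rightarrow> channel \<Rightarrow> real \<Rightarrow> real \<Rightarrow> nat \<Rightarrow> (nat \<Rightarrow> nat \<Rightarrow> packet set)
     \<Rightarrow> ((nat \<Rightarrow> nat) \<Rightarrow> delivery) \<Rightarrow> bool" where
  "valid_policy KT KR nT N h \<mu> r F cache deliv \<longleftrightarrow>
     F \<ge> 1 \<and> valid_cache KT N \<mu> F cache \<and>
     (\<forall>d\<in>requests KR N. valid_delivery KT KR nT N r h F cache d (deliv d))"


definition fronthaul_ndt :: "nat \<Rightarrow> real \<Rightarrow> nat \<Rightarrow> delivery \<Rightarrow> real" where
  "fronthaul_ndt KT r F D =
     (if r = 0 then 0 else real (Max ((\<lambda>i. card (fronthaul D i)) ` {..<KT})) / (real F * r))"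

definition edge_ndt :: "nat \<Rightarrow> delivery \<Rightarrow> real" where
  "edge_ndt F D = real (num_blocks D) / real F"

definition policy_ndt ::
  "nat \<Rightarrow> nat \<Rightarrow> nat \<Rightarrow> real \<Rightarrow> nat \<Rightarrow> ((nat \<Rightarrow> nat) \<Rightarrow> delivery) \<Rightarrow> real" where
  "policy_ndt KT KR N r F deliv =
     Max ((\<lambda>d. fronthaul_ndt KT r F (deliv d) + edge_ndt F (deliv d)) ` requests KR N)"

text \<open>The infimum of the empty set is \<open>\<infinity>\<close>.\<close>

definition delta_bar ::
  "nat \<Rightarrow> nat \<Rightarrow> nat \<Rightarrow> nat \<Rightarrow> channel \<Rightarrow> real \<Rightarrow> real \<Rightarrow> ereal" where
  "delta_bar KT KR nT N h \<mu> r =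
     Inf {ereal (policy_ndt KT KR N r F deliv) | F cache deliv.
            valid_policy KT KR nT N h \<mu> r F cache deliv}"


text \<open>
  Convexity of an extended-real-valued function on \<open>S\<close> is convexity of its epigraph; this avoids
  sums of the form \<open>\<infinity> - \<infinity>\<close>.  The lower convex envelope is the pointwise largest convex minorant.
\<close>

definition ereal_convex_on :: "real set \<Rightarrow> (real \<Rightarrow> ereal) \<Rightarrow> bool" where
  "ereal_convex_on S g \<longleftrightarrow> convex {(x, t :: real). x \<in> S \<and> g x \<le> ereal t}"

definition lower_convex_envelope :: "real set \<Rightarrow> (real \<Rightarrow> ereal) \<Rightarrow> real \<Rightarrow> ereal" where
  "lower_convex_envelope S f x = Sup {g x | g. ereal_convex_on S g \<and> (\<forall>y\<in>S. g y \<le> f y)}"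

definition delta_star ::
  "nat \<Rightarrow> nat \<Rightarrow> nat \<Rightarrow> nat \<Rightarrow> channel \<Rightarrow> real \<Rightarrow> real \<Rightarrow> ereal" where
  "delta_star KT KR nT N h \<mu> r =
     lower_convex_envelope {0..1} (\<lambda>\<mu>'. delta_bar KT KR nT N h \<mu>' r) \<mu>"


definition m_max :: "nat \<Rightarrow> nat \<Rightarrow> nat \<Rightarrow> int" where
  "m_max KT KR nT = min (int KT) \<lceil>real KR / real nT\<rceil>"

definition r_th :: "nat \<Rightarrow> nat \<Rightarrow> nat \<Rightarrow> real" where
  "r_th KT KR nT = real nT / real KT * (real_of_int (m_max KT KR nT))\<^sup>2"

definition m_star :: "nat \<Rightarrow> nat \<Rightarrow> nat \<Rightarrow> real \<Rightarrow> real" where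
  "m_star KT KR nT r =
     (if r < r_th KT KR nT then max (sqrt (real KT * r / real nT)) 1
      else real_of_int (m_max KT KR nT))"

text \<open>
  If \<open>r = 0\<close>, the first quotient in the case \<open>\<mu> * KT < m_star\<close> has positive numerator and
  denominator 0, and is read as \<open>\<infinity>\<close> (real division would yield 0).
\<close>

definition delta_lb :: "nat \<Rightarrow> nat \<Rightarrow> nat \<Rightarrow> real \<Rightarrow> real \<Rightarrow> ereal" where
  "delta_lb KT KR nT \<mu> r =
     (let m = m_star KT KR nT r in
      if \<mu> * real KT < m then
        (if r = 0 then \<infinity>
         else ereal (max (real KR * (m - \<mu> * real KT) / (real KT * r) + real KR / (m * real nT)) 1))
      else ereal (max (real KR / (\<mu> * real KT * real nT)) 1))"

end

theory Submission
  imports Defs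
begin

text \<open>
  If a packet is available at \<open>m\<close> edge nodes, its stream has \<open>m * nT\<close> free coefficients, so by
  non-degeneracy it can be nulled at fewer than \<open>m * nT\<close> other users; hence at most \<open>m * nT\<close> users
  are served together with it.  For pairwise distinct requests, counting blocks gives
  \<open>B \<ge> (\<Sum>p. 1 / min KR (nT * m p))\<close>, while counting copies gives
  \<open>(\<Sum>p. m p) \<le> KR * F * \<mu> * KT + KT * T\<close> for a maximal fronthaul load \<open>T\<close>.
  An affine lower bound \<open>c0 - c1 * m\<close> of \<open>KR / min KR (nT * m)\<close> at the integers \<open>1 \<le> m \<le> KT\<close>
  combines the two into the lower bound \<open>c0 - c1 * KT * \<mu>\<close> on the NDT as soon as
  \<open>c1 * KT * r \<le> KR\<close>.  This bound is affine in \<open>\<mu>\<close>, hence inherited by the convex envelope, and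
  \<open>delta_lb\<close> is a pointwise supremum of such bounds.
\<close>

section \<open>Linear algebra: the kernel of an invertible submatrix\<close>

lemma pick_bij_betw:
  assumes "finite J"
  shows "bij_betw (pick J) {..<card J} J"
proof -
  have inj: "inj_on (pick J) {..<card J}"
    by (rule linorder_inj_onI') (metis lessThan_iff pick_mono_le less_irrefl)
  moreover have "pick J ` {..<card J} \<subseteq> J"
    by (auto intro: pick_in_set_le)
  ultimately have "pick J ` {..<card J} = J"
    using assms by (metis card_image card_lessThan card_subset_eq)
  with inj show ?thesis
    by (simp add: bij_betw_def)
qed

text \<open>Apply the left inverse to \<open>X *\<^sub>v y = 0\<close>. The coefficients
  \<open>w\<close> keep the original column numbers, with \<open>pick\<close> translating to the
  renumbered entries of \<open>submatrix\<close>, so that nulling equations can be used in channel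
  indices.\<close>

lemma invertible_submatrix_kernel:
  fixes A :: "'a :: comm_ring_1 mat"
  assumes "invertible_mat (submatrix A I J)"
    and "I \<subseteq> {..<dim_row A}" and J: "J \<subseteq> {..<dim_col A}"
    and zero: "\<And>k. k \<in> I \<Longrightarrow> (\<Sum>c\<in>J. A $$ (k, c) * w c) = 0"
    and "c \<in> J"
  shows "w c = 0"
proof -
  define X where "X = submatrix A I J"
  define y where "y = vec (card J) (\<lambda>j. w (pick J j))"
  have finJ: "finite J" and finI: "finite I"
    using assms by (auto intro: finite_subset)
  have rows: "{i. i < dim_row A \<and> i \<in> I} = I" and cols: "{j. j < dim_col A \<and> j \<in> J} = J"
    using assms by auto
  have dims: "dim_row X = card I" "dim_col X = card J"
    by (simp_all add: X_def dim_submatrix rows cols)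
  from assms(1) obtain B where B: "B * X = 1\<^sub>m (dim_row B)" and sq: "dim_row X = dim_col X"
    and B': "X * B = 1\<^sub>m (dim_row X)"
    unfolding invertible_mat_def inverts_mat_def X_def by auto
  \<comment> \<open>\<open>invertible_mat\<close> does not state the shape of the inverse; it is
    read off from the two products.\<close>
  have "dim_row B = dim_col X"
    by (metis B index_mult_mat(3) index_one_mat(3))
  moreover have "dim_col B = dim_row X"
    by (metis B' index_mult_mat(3) index_one_mat(3))
  ultimately have carr: "B \<in> carrier_mat (card J) (card J)" "X \<in> carrier_mat (card J) (card J)"
    "y \<in> carrier_vec (card J)"
    using dims sq by (auto simp: y_def)
  have "X *\<^sub>v y = 0\<^sub>v (card J)"
  proof (rule eq_vecI)
    fix i assume "i < dim_vec (0\<^sub>v (card J) :: 'a vec)"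
    then have i: "i < card I"
      using dims sq by simp
    have "(X *\<^sub>v y) $ i = (\<Sum>j<card J. X $$ (i, j) * w (pick J j))"
      using i dims by (simp add: scalar_prod_def y_def lessThan_atLeast0)
    also have "\<dots> = (\<Sum>j<card J. A $$ (pick I i, pick J j) * w (pick J j))"
      using i by (intro sum.cong) (auto simp: X_def submatrix_index rows cols)
    also have "\<dots> = (\<Sum>c\<in>J. A $$ (pick I i, c) * w c)"
      by (rule sum.reindex_bij_betw[OF pick_bij_betw[OF finJ]])
    also have "\<dots> = 0"
      using i by (intro zero pick_in_set_le)
    finally show "(X *\<^sub>v y) $ i = 0\<^sub>v (card J) $ i"
      using i dims sq by simp
  qed (use dims sq in simp)
  then have "B *\<^sub>v (X *\<^sub>v y) = 0\<^sub>v (card J)"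
    using carr by (intro eq_vecI) (auto simp: scalar_prod_def)
  then have "y = 0\<^sub>v (card J)"
    using carr B by (metis assoc_mult_mat_vec carrier_matD(1) one_mult_mat_vec)
  moreover obtain j where "j < card J" "c = pick J j"
    using pick_bij_betw[OF finJ] \<open>c \<in> J\<close> unfolding bij_betw_def by auto
  ultimately show ?thesis
    by (metis index_vec index_zero_vec(1) y_def)
qed

section \<open>The zero-forcing limit on the users served in one block\<close>

text \<open>This is \<open>m p\<close> of the outline. A node that both caches and receives the
  packet counts once.\<close>

definition copies :: "nat \<Rightarrow> nat \<Rightarrow> (nat \<Rightarrow> nat \<Rightarrow> packet set) \<Rightarrow> delivery \<Rightarrow> packet \<Rightarrow> nat" where
  "copies KT N cache D p = card {i. i < KT \<and> p \<in> available N cache D i}"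

lemma copies_le: "copies KT N cache D p \<le> KT"
  unfolding copies_def using card_mono[of "{..<KT}" "{i. i < KT \<and> p \<in> available N cache D i}"]
  by auto

text \<open>Column \<open>c\<close> of the channel matrix is antenna \<open>c mod n\<close> of node
  \<open>c div n\<close>, so each selected node contributes \<open>n\<close> columns.\<close>

lemma card_div_mem:
  fixes n K :: nat
  assumes "0 < n"
  shows "card {c. c < K * n \<and> c div n \<in> {i. i < K \<and> P i}} = n * card {i. i < K \<and> P i}"
proof -
  let ?S = "{i. i < K \<and> P i}"
  have "bij_betw (\<lambda>c. (c div n, c mod n)) {c. c < K * n \<and> c div n \<in> ?S} (?S \<times> {..<n})"
  proof (rule bij_betwI[where g = "\<lambda>(i, a). i * n + a"])
    show "(\<lambda>(i, a). i * n + a) \<in> ?S \<times> {..<n} \<rightarrow> {c. c < K * n \<and> c div n \<in> ?S}"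
    proof clarsimp
      fix i a assume "i < K" "a < n"
      then have "i * n + a < Suc i * n" "Suc i * n \<le> K * n"
        by (simp, intro mult_le_mono1) simp
      then show "i * n + a < K * n"
        by (rule less_le_trans)
    qed
  qed (use assms in auto)
  then have "card {c. c < K * n \<and> c div n \<in> ?S} = card (?S \<times> {..<n})"
    by (rule bij_betw_same_card)
  then show ?thesis
    by (simp add: card_cartesian_product)
qed

text \<open>Otherwise the other served users supply at least as many nulling equations as there are
  active antennas. A square subsystem is invertible, so the whole precoder of the stream vanishes,
  against its nonzero gain at \<open>k\<close>. The case of no copies is included.\<close>

lemma served_card_le:
  assumes nT: "1 \<le> nT" and nondeg: "nondegenerate_channel KT KR nT h"
    and valid: "valid_block KT KR nT N h F cache d D b" and k: "k \<in> served D b"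
  shows "card (served D b) \<le> nT * copies KT N cache D (sent_packet D b k)"
proof (rule ccontr)
  assume contr: "\<not> ?thesis"
  define A where "A = channel_mat KT KR nT h b"
  define S where "S = {i. i < KT \<and> sent_packet D b k \<in> available N cache D i}"
  define J where "J = {c. c < KT * nT \<and> c div nT \<in> S}"
  \<comment> \<open>The precoders of the stream of user \<open>k\<close>, concatenated in the column
    order of the channel matrix.\<close>
  define w where "w = (\<lambda>c. vec_index (precoder D b (c div nT) k) (c mod nT))"
  have dims: "dim_row A = KR" "dim_col A = KT * nT"
    by (simp_all add: A_def channel_mat_def)
  have sub: "served D b \<subseteq> {..<KR}"
    and prec: "\<And>i. i < KT \<Longrightarrow> precoder D b i k \<in> carrier_vec nT"
    and prec0: "\<And>i. i < KT \<Longrightarrow> i \<notin> S \<Longrightarrow> precoder D b i k = 0\<^sub>v nT"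
    and gain: "stream_gain KT h D b k k \<noteq> 0"
    and gain0: "\<And>k'. k' \<in> served D b - {k} \<Longrightarrow> stream_gain KT h D b k' k = 0"
    using valid k by (auto simp: valid_block_def S_def)
  have cardJ: "card J = nT * copies KT N cache D (sent_packet D b k)"
    using card_div_mem[of nT KT "\<lambda>i. sent_packet D b k \<in> available N cache D i"] nT
    by (simp add: J_def S_def copies_def)
  have fin: "finite (served D b)"
    using sub finite_subset by blast
  have gain_eq: "stream_gain KT h D b k' k = (\<Sum>c\<in>J. A $$ (k', c) * w c)" if "k' < KR" for k'
  proof -
    have "stream_gain KT h D b k' k = (\<Sum>i<KT. \<Sum>a<nT. vec_index (h b k' i) a * vec_index (precoder D b i k) a)"
      unfolding stream_gain_def scalar_prod_def
    proof (rule sum.cong[OF refl])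
      fix i assume "i \<in> {..<KT}"
      then have "dim_vec (precoder D b i k) = nT"
        using prec[of i] by auto
      then show "(\<Sum>a = 0..<dim_vec (precoder D b i k). vec_index (h b k' i) a * vec_index (precoder D b i k) a)
          = (\<Sum>a<nT. vec_index (h b k' i) a * vec_index (precoder D b i k) a)"
        by (simp add: lessThan_atLeast0)
    qed
    also have "\<dots> = (\<Sum>i<KT. \<Sum>c\<in>{i * nT..<i * nT + nT}. A $$ (k', c) * w c)"
    proof (rule sum.cong[OF refl])
      fix i assume i: "i \<in> {..<KT}"
      then have le: "Suc i * nT \<le> KT * nT"
        by (intro mult_le_mono1) auto
      have "(\<Sum>c\<in>{i * nT..<i * nT + nT}. A $$ (k', c) * w c)
          = (\<Sum>a<nT. A $$ (k', a + i * nT) * w (a + i * nT))"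
        using sum.shift_bounds_nat_ivl[of "\<lambda>c. A $$ (k', c) * w c" 0 "i * nT" nT]
        by (simp add: lessThan_atLeast0 add.commute)
      also have "\<dots> = (\<Sum>a<nT. vec_index (h b k' i) a * vec_index (precoder D b i k) a)"
        using le that by (intro sum.cong) (auto simp: A_def channel_mat_def w_def)
      finally show "(\<Sum>a<nT. vec_index (h b k' i) a * vec_index (precoder D b i k) a)
          = (\<Sum>c\<in>{i * nT..<i * nT + nT}. A $$ (k', c) * w c)" ..
    qed
    also have "\<dots> = (\<Sum>c<KT * nT. A $$ (k', c) * w c)"
      by (rule sum.nat_group)
    \<comment> \<open>Columns outside \<open>J\<close> belong to nodes without the packet, whose
      precoders are zero.\<close>
    also have "\<dots> = (\<Sum>c\<in>J. A $$ (k', c) * w c)"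
    proof (rule sum.mono_neutral_right)
      show "\<forall>c\<in>{..<KT * nT} - J. A $$ (k', c) * w c = 0"
      proof
        fix c assume c: "c \<in> {..<KT * nT} - J"
        then have "c div nT < KT" "c div nT \<notin> S"
          by (auto simp: J_def less_mult_imp_div_less)
        then show "A $$ (k', c) * w c = 0"
          using prec0 nT by (simp add: w_def)
      qed
    qed (auto simp: J_def)
    finally show ?thesis .
  qed
  have "card J \<le> card (served D b - {k})"
    using contr cardJ k fin by simp
  then obtain I where I: "I \<subseteq> served D b - {k}" "card I = card J"
    by (metis obtain_subset_with_card_n)
  have "w c = 0" if "c \<in> J" for c
  proof (rule invertible_submatrix_kernel[OF _ _ _ _ that])
    show "invertible_mat (submatrix A I J)"
    proof -
      have "I \<subseteq> {..<KR}" "J \<subseteq> {..<KT * nT}"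
        using I sub by (auto simp: J_def)
      then show ?thesis
        using nondeg I(2) unfolding nondegenerate_channel_def A_def by blast
    qed
    show "I \<subseteq> {..<dim_row A}" "J \<subseteq> {..<dim_col A}"
      using I sub by (auto simp: dims J_def)
    show "(\<Sum>c\<in>J. A $$ (k', c) * w c) = 0" if "k' \<in> I" for k'
    proof -
      have "k' \<in> served D b - {k}" using that I by auto
      then show ?thesis
        using gain_eq[of k'] gain0[of k'] sub by auto
    qed
  qed
  then have "stream_gain KT h D b k k = 0"
    using gain_eq[of k] k sub by auto
  with gain show False ..
qed

section \<open>Counting blocks and counting copies\<close>

text \<open>Charge each pair of a user and a requested packet to one block delivering it, with
  weight one over the number of users served there. By \<open>served_card_le\<close> this weight is
  at least the summand, and a block collects total weight at most 1.\<close>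

lemma num_blocks_ge:
  assumes nT: "1 \<le> nT" and nondeg: "nondegenerate_channel KT KR nT h"
    and valid: "valid_delivery KT KR nT N r h F cache d D"
  shows "(\<Sum>k<KR. \<Sum>p\<in>file_packets F (d k). 1 / real (min KR (nT * copies KT N cache D p)))
      \<le> real (num_blocks D)"
proof -
  define Q where "Q = Sigma {..<KR} (\<lambda>k. file_packets F (d k))"
  define E where "E = Sigma {..<num_blocks D} (served D)"
  have vb: "valid_block KT KR nT N h F cache d D b" if "b < num_blocks D" for b
    using valid that by (auto simp: valid_delivery_def)
  have sub: "served D b \<subseteq> {..<KR}" if "b < num_blocks D" for b
    using vb[OF that] by (auto simp: valid_block_def)
  have finE: "finite E"
    unfolding E_def using sub by (intro finite_SigmaI) (auto intro: finite_subset)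
  have finp: "finite (file_packets F n)" for n
    by (simp add: file_packets_def)
  have "\<forall>q\<in>Q. \<exists>b. b < num_blocks D \<and> fst q \<in> served D b \<and> sent_packet D b (fst q) = snd q"
    using valid by (auto simp: valid_delivery_def Q_def)
  then obtain \<beta> where \<beta>: "\<And>q. q \<in> Q \<Longrightarrow> \<beta> q < num_blocks D \<and> fst q \<in> served D (\<beta> q)
      \<and> sent_packet D (\<beta> q) (fst q) = snd q"
    by metis
  \<comment> \<open>A block carries only one packet per user, so block and user determine the
    packet.\<close>
  have inj: "inj_on (\<lambda>q. (\<beta> q, fst q)) Q"
    by (rule inj_onI) (metis \<beta> prod.inject prod.expand)
  have "(\<Sum>k<KR. \<Sum>p\<in>file_packets F (d k). 1 / real (min KR (nT * copies KT N cache D p)))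
      = (\<Sum>q\<in>Q. 1 / real (min KR (nT * copies KT N cache D (snd q))))"
    unfolding Q_def by (subst sum.Sigma) (auto simp: finp case_prod_unfold)
  also have "\<dots> \<le> (\<Sum>q\<in>Q. 1 / real (card (served D (\<beta> q))))"
  proof (rule sum_mono)
    fix q assume q: "q \<in> Q"
    have "finite (served D (\<beta> q))"
      using sub[of "\<beta> q"] \<beta>[OF q] finite_subset by blast
    then have "0 < card (served D (\<beta> q))"
      using \<beta>[OF q] card_gt_0_iff by blast
    moreover have "card (served D (\<beta> q)) \<le> KR"
      using card_mono[OF _ sub[of "\<beta> q"]] \<beta>[OF q] by simp
    moreover have "card (served D (\<beta> q)) \<le> nT * copies KT N cache D (snd q)"
      using served_card_le[OF nT nondeg vb] \<beta>[OF q] by metis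
    ultimately show "1 / real (min KR (nT * copies KT N cache D (snd q)))
        \<le> 1 / real (card (served D (\<beta> q)))"
      by (intro divide_left_mono of_nat_mono mult_pos_pos) (auto simp flip: of_nat_mult intro: Nat.gr0I)
  qed
  also have "\<dots> = (\<Sum>e\<in>(\<lambda>q. (\<beta> q, fst q)) ` Q. 1 / real (card (served D (fst e))))"
    by (simp add: sum.reindex[OF inj])
  also have "\<dots> \<le> (\<Sum>e\<in>E. 1 / real (card (served D (fst e))))"
    using \<beta> by (intro sum_mono2 finE) (auto simp: E_def)
  also have "\<dots> = (\<Sum>b<num_blocks D. \<Sum>k\<in>served D b. 1 / real (card (served D b)))"
    unfolding E_def using sub
    by (subst sum.Sigma) (auto simp: case_prod_unfold intro: finite_subset)
  \<comment> \<open>Only an inequality: a block serving nobody contributes 0.\<close>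
  also have "\<dots> \<le> (\<Sum>b<num_blocks D. 1)"
    by (intro sum_mono) simp
  finally show ?thesis by simp
qed

text \<open>Ensures that the affine estimate, available only for \<open>m\<close> at least 1,
  applies to every requested packet.\<close>

lemma copies_pos:
  assumes nT: "1 \<le> nT" and nondeg: "nondegenerate_channel KT KR nT h"
    and valid: "valid_delivery KT KR nT N r h F cache d D"
    and "k < KR" "p \<in> file_packets F (d k)"
  shows "1 \<le> copies KT N cache D p"
proof -
  obtain b where b: "b < num_blocks D" "k \<in> served D b" "sent_packet D b k = p"
    using valid assms(4,5) unfolding valid_delivery_def by blast
  then have vb: "valid_block KT KR nT N h F cache d D b"
    using valid by (auto simp: valid_delivery_def)
  then have "finite (served D b)"
    by (auto simp: valid_block_def intro: finite_subset)
  then have "0 < card (served D b)"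
    using b card_gt_0_iff by blast
  also have "\<dots> \<le> nT * copies KT N cache D p"
    using served_card_le[OF nT nondeg vb b(2)] b(3) by simp
  finally show ?thesis
    by (simp add: Suc_le_eq)
qed

text \<open>Double counting of pairs of a packet and a node holding it. Distinct requests make the
  packet sets disjoint, so the sum over users is a sum over packets.\<close>

lemma sum_copies_le:
  fixes d :: "nat \<Rightarrow> nat"
  assumes cache: "valid_cache KT N \<mu> F cache"
    and fh: "\<And>i. i < KT \<Longrightarrow> finite (fronthaul D i)"
    and d: "inj_on d {..<KR}" "d ` {..<KR} \<subseteq> {..<N}"
  shows "(\<Sum>k<KR. \<Sum>p\<in>file_packets F (d k). copies KT N cache D p)
      \<le> (\<Sum>i<KT. (\<Sum>k<KR. card (cache i (d k))) + card (fronthaul D i))"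
proof -
  define P where "P = (\<Union>k<KR. file_packets F (d k))"
  have finp: "finite (file_packets F n)" for n
    by (simp add: file_packets_def)
  have finP: "finite P"
    unfolding P_def by (intro finite_UN_I finite_lessThan finp)
  have csub: "cache i n \<subseteq> file_packets F n" if "i < KT" "n < N" for i n
    using cache that by (auto simp: valid_cache_def)
  have "(\<Sum>k<KR. \<Sum>p\<in>file_packets F (d k). copies KT N cache D p) = (\<Sum>p\<in>P. copies KT N cache D p)"
    unfolding P_def using d(1)
    by (subst sum.UNION_disjoint) (auto simp: finp, auto simp: file_packets_def inj_on_def)
  also have "\<dots> = (\<Sum>p\<in>P. \<Sum>i<KT. if p \<in> available N cache D i then 1 else 0)"
    by (simp add: copies_def flip: sum.inter_filter)
  also have "\<dots> = (\<Sum>i<KT. card {p \<in> P. p \<in> available N cache D i})"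
    by (subst sum.swap) (simp add: finP flip: sum.inter_filter)
  also have "\<dots> \<le> (\<Sum>i<KT. (\<Sum>k<KR. card (cache i (d k))) + card (fronthaul D i))"
  proof (rule sum_mono)
    fix i assume "i \<in> {..<KT}"
    then have i: "i < KT" by simp
    have dN: "d k < N" if "k < KR" for k
      using d(2) that by auto
    have fc: "finite (cache i (d k))" if "k < KR" for k
      using csub[OF i dN[OF that]] finp finite_subset by blast
    have "{p \<in> P. p \<in> available N cache D i} \<subseteq> (\<Union>k<KR. cache i (d k)) \<union> fronthaul D i"
    proof
      fix p assume "p \<in> {p \<in> P. p \<in> available N cache D i}"
      then obtain k where k: "k < KR" "p \<in> file_packets F (d k)" and "p \<in> available N cache D i"
        by (auto simp: P_def)
      then consider "p \<in> fronthaul D i" | n where "n < N" "p \<in> cache i n"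
        by (auto simp: available_def)
      then show "p \<in> (\<Union>k<KR. cache i (d k)) \<union> fronthaul D i"
      proof cases
        case 2
        \<comment> \<open>A packet carries its file number, so cached packets of other files are
          irrelevant here.\<close>
        then have "n = d k"
          using csub[OF i, of n] k(2) by (auto simp: file_packets_def)
        with 2 k(1) show ?thesis by auto
      qed simp
    qed
    then have "card {p \<in> P. p \<in> available N cache D i}
        \<le> card ((\<Union>k<KR. cache i (d k)) \<union> fronthaul D i)"
      using fc fh[OF i] by (intro card_mono) auto
    also have "\<dots> \<le> card (\<Union>k<KR. cache i (d k)) + card (fronthaul D i)"
      by (rule card_Un_le)
    also have "\<dots> \<le> (\<Sum>k<KR. card (cache i (d k))) + card (fronthaul D i)"
      by (simp add: card_UN_le)
    finally show "card {p \<in> P. p \<in> available N cache D i}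
        \<le> (\<Sum>k<KR. card (cache i (d k))) + card (fronthaul D i)" .
  qed
  finally show ?thesis .
qed

lemma policy_ndt_ge:
  assumes "d \<in> requests KR N"
  shows "fronthaul_ndt KT r F (deliv d) + edge_ndt F (deliv d) \<le> policy_ndt KT KR N r F deliv"
proof -
  have "finite (requests KR N)"
    unfolding requests_def by (intro finite_PiE) auto
  then show ?thesis
    unfolding policy_ndt_def using assms by (intro Max_ge) auto
qed

section \<open>Affine lower bounds on the NDT and their passage to the convex envelope\<close>

text \<open>Sum the affine estimate over all \<open>KR * F\<close> requested packets and insert both
  counts. Here \<open>c1\<close> acts as the price of a copy; the bound on
  \<open>c1 * KT * r\<close> makes the price of the fronthaul copies at most the fronthaul
  NDT.\<close>

lemma policy_ndt_affine_bound:
  fixes c0 c1 :: real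
  assumes KT: "1 \<le> KT" and KR: "1 \<le> KR" and nT: "1 \<le> nT" and N: "KR \<le> N" and r: "0 \<le> r"
    and nondeg: "nondegenerate_channel KT KR nT h"
    and policy: "valid_policy KT KR nT N h \<mu> r F cache deliv"
    and c1: "0 \<le> c1" "c1 * real KT * r \<le> real KR"
    and affine: "\<And>m. 1 \<le> m \<Longrightarrow> m \<le> KT \<Longrightarrow> c0 - c1 * real m \<le> real KR / real (min KR (nT * m))"
  shows "c0 - c1 * real KT * \<mu> \<le> policy_ndt KT KR N r F deliv"
proof -
  \<comment> \<open>User \<open>k\<close> requests file \<open>k\<close>, so all requests differ;
    this is possible since \<open>KR \<le> N\<close>.\<close>
  define d where "d = (\<lambda>k\<in>{..<KR}. k)"
  define D where "D = deliv d"
  define T where "T = Max ((\<lambda>i. card (fronthaul D i)) ` {..<KT})"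
  let ?m = "\<lambda>p. real (copies KT N cache D p)"
  have dreq: "d \<in> requests KR N"
    using N by (auto simp: d_def requests_def)
  have F: "1 \<le> F" and cache: "valid_cache KT N \<mu> F cache"
    and valid: "valid_delivery KT KR nT N r h F cache d D"
    using policy dreq by (auto simp: valid_policy_def D_def)
  have cardp: "card (file_packets F n) = F" and finp: "finite (file_packets F n)" for n
    by (auto simp: file_packets_def card_cartesian_product)
  have fh: "finite (fronthaul D i)" if "i < KT" for i
  proof (rule finite_subset)
    show "fronthaul D i \<subseteq> (\<Union>k<KR. file_packets F (d k))"
      using valid that unfolding valid_delivery_def by blast
    show "finite (\<Union>k<KR. file_packets F (d k))"
      by (intro finite_UN_I finite_lessThan finp)
  qed
  have T: "card (fronthaul D i) \<le> T" if "i < KT" for i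
    unfolding T_def using that by (intro Max_ge) auto
  have "real (\<Sum>k<KR. \<Sum>p\<in>file_packets F (d k). copies KT N cache D p)
      \<le> real (\<Sum>i<KT. (\<Sum>k<KR. card (cache i (d k))) + card (fronthaul D i))"
    using N by (intro of_nat_mono sum_copies_le[OF cache fh]) (auto simp: d_def inj_on_def)
  also have "\<dots> \<le> (\<Sum>i<KT. (\<Sum>k<KR. \<mu> * real F) + real T)"
    unfolding of_nat_sum of_nat_add using cache N T
    by (intro sum_mono add_mono) (auto simp: valid_cache_def d_def)
  finally have copies: "(\<Sum>k<KR. \<Sum>p\<in>file_packets F (d k). ?m p)
      \<le> real KT * (real KR * (\<mu> * real F) + real T)"
    by simp
  have "real KR * (real F * c0) - c1 * (real KT * (real KR * (\<mu> * real F) + real T))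
      \<le> real KR * (real F * c0) - c1 * (\<Sum>k<KR. \<Sum>p\<in>file_packets F (d k). ?m p)"
    using copies c1(1) by (simp add: mult_left_mono)
  also have "\<dots> = (\<Sum>k<KR. \<Sum>p\<in>file_packets F (d k). c0 - c1 * ?m p)"
    by (simp add: sum_subtractf sum_distrib_left cardp)
  also have "\<dots> \<le> (\<Sum>k<KR. \<Sum>p\<in>file_packets F (d k).
      real KR * (1 / real (min KR (nT * copies KT N cache D p))))"
    using copies_pos[OF nT nondeg valid] copies_le[of KT N cache D]
    by (intro sum_mono) (use affine in force)
  also have "\<dots> = real KR * (\<Sum>k<KR. \<Sum>p\<in>file_packets F (d k).
      1 / real (min KR (nT * copies KT N cache D p)))"
    by (simp only: sum_distrib_left)
  also have "\<dots> \<le> real KR * real (num_blocks D)"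
    by (intro mult_left_mono num_blocks_ge[OF nT nondeg valid]) simp
  finally have main: "real KR * (real F * c0) - c1 * (real KT * (real KR * (\<mu> * real F) + real T))
      \<le> real KR * real (num_blocks D)" .
  have "c0 - c1 * real KT * \<mu> - c1 * real KT * real T / (real KR * real F)
      = (real KR * (real F * c0) - c1 * (real KT * (real KR * (\<mu> * real F) + real T)))
        / (real KR * real F)"
    using KR F by (simp add: field_simps)
  also have "\<dots> \<le> real KR * real (num_blocks D) / (real KR * real F)"
    by (intro divide_right_mono main) simp
  also have "\<dots> = edge_ndt F D"
    using KR by (simp add: edge_ndt_def)
  finally have edge: "c0 - c1 * real KT * \<mu> - c1 * real KT * real T / (real KR * real F)
      \<le> edge_ndt F D" .
  have front: "c1 * real KT * real T / (real KR * real F) \<le> fronthaul_ndt KT r F D"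
  \<comment> \<open>Without fronthaul nothing is sent, so \<open>T = 0\<close> and both sides
    vanish.\<close>
  proof (cases "r = 0")
    case True
    then have "\<forall>i<KT. fronthaul D i = {}"
      using valid by (simp add: valid_delivery_def)
    then have "T = Max ((\<lambda>i. 0) ` {..<KT})"
      unfolding T_def by (intro arg_cong[where f = Max] image_cong) auto
    also have "\<dots> = 0"
      using KT by (simp add: image_constant_conv lessThan_empty_iff)
    finally show ?thesis
      using True by (simp add: fronthaul_ndt_def)
  next
    case False
    then have "c1 * real KT * real T / (real KR * real F)
        = (c1 * real KT * r) * (real T / (real KR * real F * r))"
      by simp
    also have "\<dots> \<le> real KR * (real T / (real KR * real F * r))"
      using r by (intro mult_right_mono c1) auto
    also have "\<dots> = fronthaul_ndt KT r F D"
      using False KR by (simp add: fronthaul_ndt_def T_def)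
    finally show ?thesis .
  qed
  show ?thesis
    using edge front policy_ndt_ge[OF dreq, of KT r F deliv] by (simp add: D_def)
qed

text \<open>The epigraph is the part of a closed half-plane lying over \<open>S\<close>.\<close>

lemma ereal_convex_on_affine:
  assumes "convex S"
  shows "ereal_convex_on S (\<lambda>x. ereal (a - b * x))"
proof -
  have "{(x, t :: real). x \<in> S \<and> ereal (a - b * x) \<le> ereal t}
      = (S \<times> UNIV) \<inter> {z. inner (- b, - 1) z \<le> - a}"
    by (auto simp: algebra_simps)
  moreover have "convex \<dots>"
    by (intro convex_Int convex_Times assms convex_UNIV convex_halfspace_le)
  ultimately show ?thesis
    unfolding ereal_convex_on_def by simp
qed

text \<open>The affine function is a convex minorant of \<open>delta_bar\<close>, hence one of the
  competitors in the envelope. The coefficients may be chosen to suit the point \<open>\<mu>\<close>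
  of evaluation.\<close>

lemma delta_star_affine_bound:
  fixes c0 c1 :: real
  assumes "1 \<le> KT" "1 \<le> KR" "1 \<le> nT" "KR \<le> N" "0 \<le> r"
    and "nondegenerate_channel KT KR nT h"
    and "0 \<le> c1" "c1 * real KT * r \<le> real KR"
    and "\<And>m. 1 \<le> m \<Longrightarrow> m \<le> KT \<Longrightarrow> c0 - c1 * real m \<le> real KR / real (min KR (nT * m))"
  shows "ereal (c0 - c1 * real KT * \<mu>) \<le> delta_star KT KR nT N h \<mu> r"
proof -
  have "ereal (c0 - c1 * real KT * \<mu>') \<le> delta_bar KT KR nT N h \<mu>' r" for \<mu>'
    unfolding delta_bar_def
    by (rule Inf_greatest) (use policy_ndt_affine_bound[OF assms(1-6) _ assms(7-9)] in force)
  moreover have "ereal_convex_on {0..1} (\<lambda>x. ereal (c0 - c1 * real KT * x))"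
    by (rule ereal_convex_on_affine) simp
  ultimately show ?thesis
    unfolding delta_star_def lower_convex_envelope_def
    by (intro Sup_upper CollectI exI[of _ "\<lambda>x. ereal (c0 - c1 * real KT * x)"]) auto
qed

section \<open>One-variable estimates and the optimality of \<open>m_star\<close>\<close>

text \<open>The difference of the two sides is \<open>(j - m) * (a * j * m - b) / (j * m)\<close>,
  and the hypothesis says that the two factors in the numerator do not have opposite signs.\<close>

lemma affine_plus_inverse_mono:
  fixes a b m j :: real
  assumes "0 < m" "0 < j" "(m \<le> j \<and> b \<le> a * j * m) \<or> (j \<le> m \<and> a * j * m \<le> b)"
  shows "a * m + b / m \<le> a * j + b / j"
proof -
  have "0 \<le> (j - m) * (a * j * m - b)"
    using assms(3) by (auto intro: mult_nonneg_nonneg mult_nonpos_nonpos)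
  then have "0 \<le> (j - m) * (a * j * m - b) / (j * m)"
    using assms(1,2) by simp
  also have "\<dots> = (a * j + b / j) - (a * m + b / m)"
    using assms(1,2) by (simp add: field_simps)
  finally show ?thesis by simp
qed

text \<open>By convexity the graph of the inverse lies above its tangent at \<open>x\<close>; the
  gap is a square over a positive number.\<close>

lemma inverse_ge_tangent:
  fixes x m :: real
  assumes "0 < x" "0 < m"
  shows "2 / x - m / x\<^sup>2 \<le> 1 / m"
proof -
  have "1 / m - (2 / x - m / x\<^sup>2) = (x - m)\<^sup>2 / (m * x\<^sup>2)"
    using assms by (simp add: field_simps power2_eq_square)
  also have "\<dots> \<ge> 0"
    using assms by simp
  finally show ?thesis by simp
qed

lemma inverse_min_ge:
  assumes "1 \<le> KR" "1 \<le> nT" "1 \<le> j"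
  shows "1 / real KR \<le> 1 / real (min KR (nT * j))" "(1 / real nT) / real j \<le> 1 / real (min KR (nT * j))"
proof -
  have "0 < min KR (nT * j)"
    using assms by simp
  then show "1 / real KR \<le> 1 / real (min KR (nT * j))"
    by (intro divide_left_mono) (use assms in auto)
  have "1 / real (nT * j) \<le> 1 / real (min KR (nT * j))"
    using \<open>0 < min KR (nT * j)\<close> by (intro divide_left_mono of_nat_mono) (use assms in auto)
  then show "(1 / real nT) / real j \<le> 1 / real (min KR (nT * j))"
    by simp
qed

text \<open>Either the number of nodes is the limit, or \<open>m_max\<close> copies already allow
  \<open>KR\<close> users per block.\<close>

lemma m_max_cases:
  assumes "1 \<le> KT" "1 \<le> KR" "1 \<le> nT"
  obtains "m_max KT KR nT = int KT"
  | "real KR / real nT \<le> real_of_int (m_max KT KR nT)"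
  using that unfolding m_max_def by (metis le_of_int_ceiling min_def)

lemma m_max_ge_1:
  assumes "1 \<le> KT" "1 \<le> KR" "1 \<le> nT"
  shows "1 \<le> m_max KT KR nT"
proof -
  have "0 < real KR / real nT"
    using assms by simp
  then have "0 < \<lceil>real KR / real nT\<rceil>"
    by simp
  then show ?thesis
    using assms unfolding m_max_def by linarith
qed

lemma m_star_ge_1:
  assumes "1 \<le> KT" "1 \<le> KR" "1 \<le> nT"
  shows "1 \<le> m_star KT KR nT r"
  using m_max_ge_1[OF assms] by (simp add: m_star_def)

text \<open>Divided by \<open>KR\<close>, this is the affine hypothesis for the largest admissible
  slope \<open>KR / (KT * r)\<close>. The curve \<open>a * t + b / t\<close> has its minimum at
  \<open>sqrt (b / a)\<close>, and \<open>m_star\<close> is this point clipped to the interval from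
  1 to \<open>m_max\<close>.\<close>

lemma m_star_line_le:
  assumes KT: "1 \<le> KT" and KR: "1 \<le> KR" and nT: "1 \<le> nT" and r: "0 < r"
    and j: "1 \<le> j" "j \<le> KT"
  defines "m \<equiv> m_star KT KR nT r"
  shows "m / (real KT * r) + (1 / real nT) / m \<le> real j / (real KT * r) + 1 / real (min KR (nT * j))"
proof -
  define a where "a = 1 / (real KT * r)"
  define b where "b = 1 / real nT"
  have m1: "1 \<le> m"
    using m_star_ge_1[OF KT KR nT] by (simp add: m_def)
  have a: "0 < a" and b: "0 < b"
    using KT nT r by (simp_all add: a_def b_def)
  have ba: "real KT * r / real nT = b / a"
    by (simp add: a_def b_def)
  have j1: "1 \<le> real j" using j by simp
  have imp: ?thesis if "a * m + b / m \<le> a * real j + b / real j"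
    using that inverse_min_ge(2)[OF KR nT j(1)] by (simp add: a_def b_def)
  show ?thesis
  proof (cases "r < r_th KT KR nT")
    case True
    then have m: "m = max (sqrt (b / a)) 1"
      by (simp add: m_def m_star_def ba)
    show ?thesis
    proof (cases "1 \<le> sqrt (b / a)")
      case True
      then have "m\<^sup>2 = b / a"
        using m a b by simp
      then have b_eq: "b = a * m * m"
        using a by (simp add: field_simps power2_eq_square)
      show ?thesis
      proof (rule imp, rule affine_plus_inverse_mono)
        show "(m \<le> real j \<and> b \<le> a * real j * m) \<or> (real j \<le> m \<and> a * real j * m \<le> b)"
          unfolding b_eq using a m1 by (cases "m \<le> real j") (auto intro!: mult_right_mono mult_left_mono)
      qed (use m1 j1 in auto)
    next
      \<comment> \<open>The unconstrained minimum lies left of 1, so the curve increases from 1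
        onwards.\<close>
      case False
      then have "m = 1" "b \<le> a"
        using m a b by (simp_all add: real_sqrt_less_iff)
      moreover have "a * 1 \<le> a * real j"
        using a j1 by (intro mult_left_mono) auto
      ultimately show ?thesis
        using j1 by (intro imp affine_plus_inverse_mono) auto
    qed
  next
    case False
    then have m: "m = real_of_int (m_max KT KR nT)"
      by (simp add: m_def m_star_def)
    have "real nT * m\<^sup>2 \<le> real KT * r"
      using False KT by (simp add: r_th_def m field_simps)
    then have "m\<^sup>2 \<le> b / a"
      using nT by (simp add: field_simps flip: ba)
    \<comment> \<open>The unconstrained minimum is not left of \<open>m\<close>, so the curve
      decreases up to \<open>m\<close>.\<close>
    then have am: "a * m * m \<le> b"
      using a by (simp add: field_simps power2_eq_square)
    show ?thesis
    proof (cases "real j \<le> m")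
      case True
      then have "a * real j * m \<le> a * m * m"
        using a m1 by (intro mult_right_mono mult_left_mono) auto
      with am True show ?thesis
        using m1 j1 by (intro imp affine_plus_inverse_mono) auto
    next
      \<comment> \<open>Since \<open>j\<close> exceeds \<open>m_max\<close>, the latter is not
        \<open>KT\<close>; hence \<open>m * nT\<close> is at least \<open>KR\<close>, and further
        copies cannot improve on the bound \<open>1 / KR\<close>.\<close>
      case False
      then have "real KR / real nT \<le> m"
        using m_max_cases[OF KT KR nT] j(2) m by (metis of_int_of_nat_eq of_nat_mono)
      then have "(1 / real nT) / m \<le> 1 / real KR"
        using KR nT m1 by (simp add: field_simps)
      also have "\<dots> \<le> 1 / real (min KR (nT * j))"
        by (rule inverse_min_ge(1)[OF KR nT j(1)])
      finally have "(1 / real nT) / m \<le> 1 / real (min KR (nT * j))" .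
      moreover have "m / (real KT * r) \<le> real j / (real KT * r)"
        using False r by (intro divide_right_mono) auto
      ultimately show ?thesis by linarith
    qed
  qed
qed

section \<open>Choosing the affine bounds that yield \<open>delta_lb\<close>\<close>

theorem proposition4:
  fixes KT KR nT N :: nat and \<mu> r :: real and h :: channel
  assumes "KT \<ge> 1" and "KR \<ge> 1" and "nT \<ge> 1" and "N \<ge> KR"
    and "0 \<le> \<mu>" and "\<mu> \<le> 1" and "0 \<le> r"
    and "nondegenerate_channel KT KR nT h"
  shows "delta_star KT KR nT N h \<mu> r \<ge> delta_lb KT KR nT \<mu> r"
proof -
  note bound = delta_star_affine_bound[OF assms(1-4) assms(7,8)]
  note KT = assms(1) and KR = assms(2) and nT = assms(3) and r = assms(7)
  define m where "m = m_star KT KR nT r"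
  define x where "x = \<mu> * real KT"
  let ?ds = "delta_star KT KR nT N h \<mu> r"
  have m1: "1 \<le> m"
    using m_star_ge_1[OF KT KR nT] by (simp add: m_def)
  have ge1: "ereal 1 \<le> ?ds"
  proof -
    \<comment> \<open>The constant bound, with slope 0: a block serves at most \<open>KR\<close>
      users.\<close>
    have "ereal (1 - 0 * real KT * \<mu>) \<le> ?ds"
    proof (rule bound)
      fix j :: nat assume "1 \<le> j"
      from mult_left_mono[OF inverse_min_ge(1)[OF KR nT this], of "real KR"]
      show "1 - 0 * real j \<le> real KR / real (min KR (nT * j))"
        using KR by simp
    qed auto
    then show ?thesis by simp
  qed
  consider (line) "x < m" "0 < r" | (no_fronthaul) "x < m" "r = 0" | (edge_only) "m \<le> x"
    using r by linarith
  then show ?thesis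
  proof cases
    case line
    have "ereal (real KR * (m / (real KT * r) + (1 / real nT) / m)
        - real KR / (real KT * r) * real KT * \<mu>) \<le> ?ds"
    proof (rule bound)
      fix j :: nat assume "1 \<le> j" "j \<le> KT"
      from mult_left_mono[OF m_star_line_le[OF KT KR nT line(2) this], of "real KR"]
      show "real KR * (m / (real KT * r) + (1 / real nT) / m) - real KR / (real KT * r) * real j
          \<le> real KR / real (min KR (nT * j))"
        by (simp add: m_def algebra_simps)
    qed (use KT line in auto)
    also have "real KR * (m / (real KT * r) + (1 / real nT) / m) - real KR / (real KT * r) * real KT * \<mu>
        = real KR * (m - x) / (real KT * r) + real KR / (m * real nT)"
      by (simp add: x_def algebra_simps diff_divide_distrib)
    finally show ?thesis
      using ge1 line by (simp add: delta_lb_def Let_def max_def flip: m_def x_def)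
  next
    case no_fronthaul
    have "0 < r_th KT KR nT"
      using m_max_ge_1[OF KT KR nT] KT nT by (simp add: r_th_def)
    \<comment> \<open>For \<open>r = 0\<close> the square root vanishes and \<open>m_star\<close> is
      1.\<close>
    then have x1: "x < 1"
      using no_fronthaul by (simp add: m_def m_star_def)
    \<comment> \<open>With \<open>r = 0\<close> every nonnegative slope is admissible. These lines
      vanish at one copy, so they are nonpositive at all integers \<open>j \<ge> 1\<close>; letting
      \<open>c\<close> grow forces the value \<open>\<infinity>\<close>.\<close>
    have steep: "ereal (c * (1 - x)) \<le> ?ds" if "0 \<le> c" for c
    proof -
      have "ereal (c - c * real KT * \<mu>) \<le> ?ds"
      proof (rule bound)
        fix j :: nat assume "1 \<le> j"
        then have "c * 1 \<le> c * real j"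
          using that by (intro mult_left_mono) auto
        then have "c - c * real j \<le> 0" by simp
        also have "0 \<le> real KR / real (min KR (nT * j))" by simp
        finally show "c - c * real j \<le> real KR / real (min KR (nT * j))" .
      qed (use that no_fronthaul in auto)
      then show ?thesis by (simp add: x_def algebra_simps)
    qed
    have "?ds = \<infinity>"
    proof (rule ereal_top)
      fix B :: real
      have "ereal B \<le> ereal (\<bar>B\<bar> / (1 - x) * (1 - x))"
        using x1 by simp
      also have "\<dots> \<le> ?ds"
        using x1 by (intro steep) simp
      finally show "ereal B \<le> ?ds" .
    qed
    then show ?thesis by simp
  next
    case edge_only
    then have x1: "1 \<le> x" using m1 by simp
    have "ereal (real KR / (x * real nT)) \<le> ?ds"
    proof (cases "r < r_th KT KR nT")
      case True
      then have "sqrt (real KT * r / real nT) \<le> x"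
        using edge_only by (simp add: m_def m_star_def)
      then have "real KT * r / real nT \<le> x\<^sup>2"
        using x1 sqrt_le_D by blast
      \<comment> \<open>The tangent to \<open>KR / (nT * t)\<close> at \<open>t = x\<close> has
        admissible slope because \<open>x\<close> is at least \<open>sqrt (KT * r / nT)\<close>. It
        is exact at the point of evaluation.\<close>
      then have slope: "real KR / (real nT * x\<^sup>2) * real KT * r \<le> real KR"
        using x1 nT KR by (simp add: field_simps)
      have "ereal (2 * real KR / (real nT * x) - real KR / (real nT * x\<^sup>2) * real KT * \<mu>) \<le> ?ds"
      proof (rule bound[OF _ slope])
        fix j :: nat assume j: "1 \<le> j" "j \<le> KT"
        have "2 * real KR / (real nT * x) - real KR / (real nT * x\<^sup>2) * real j
            = real KR * ((1 / real nT) * (2 / x - real j / x\<^sup>2))"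
          by (simp add: algebra_simps)
        also have "\<dots> \<le> real KR * ((1 / real nT) * (1 / real j))"
          using x1 j by (intro mult_left_mono inverse_ge_tangent) auto
        also have "\<dots> \<le> real KR * (1 / real (min KR (nT * j)))"
          using inverse_min_ge(2)[OF KR nT j(1)] by (intro mult_left_mono) auto
        finally show "2 * real KR / (real nT * x) - real KR / (real nT * x\<^sup>2) * real j
            \<le> real KR / real (min KR (nT * j))"
          by simp
      qed simp
      also have "2 * real KR / (real nT * x) - real KR / (real nT * x\<^sup>2) * real KT * \<mu>
          = 2 * real KR / (real nT * x) - real KR / (real nT * x\<^sup>2) * x"
        by (simp add: x_def)
      also have "\<dots> = real KR / (x * real nT)"
        using x1 nT by (simp add: field_simps power2_eq_square)
      finally show ?thesis .
    next
      case False
      then have m: "m = real_of_int (m_max KT KR nT)"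
        by (simp add: m_def m_star_def)
      \<comment> \<open>The tangent slope need not be admissible now. Either \<open>m_max\<close> is
        \<open>KT\<close>, which forces \<open>\<mu> = 1\<close>, and the constant bound at
        \<open>KT\<close> copies suffices; or the quotient is at most 1 and \<open>ge1\<close>
        suffices.\<close>
      from m_max_cases[OF KT KR nT] show ?thesis
      proof cases
        case 1
        then have "1 * real KT \<le> \<mu> * real KT"
          using edge_only m by (simp add: x_def)
        then have x: "x = real KT"
          using KT assms(6) by (simp add: x_def)
        have "ereal (real KR * ((1 / real nT) / real KT) - 0 * real KT * \<mu>) \<le> ?ds"
        proof (rule bound)
          fix j :: nat assume j: "1 \<le> j" "j \<le> KT"
          have "(1 / real nT) / real KT \<le> (1 / real nT) / real j"
            using j by (intro divide_left_mono) auto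
          also have "\<dots> \<le> 1 / real (min KR (nT * j))"
            by (rule inverse_min_ge(2)[OF KR nT j(1)])
          finally have "real KR * ((1 / real nT) / real KT) \<le> real KR * (1 / real (min KR (nT * j)))"
            by (intro mult_left_mono) auto
          then show "real KR * ((1 / real nT) / real KT) - 0 * real j \<le> real KR / real (min KR (nT * j))"
            by simp
        qed auto
        then show ?thesis
          by (simp add: x mult.commute)
      next
        case 2
        then have "real KR / real nT \<le> x"
          using m edge_only by simp
        then have "real KR / (x * real nT) \<le> 1"
          using x1 nT by (simp add: field_simps)
        then have "ereal (real KR / (x * real nT)) \<le> ereal 1"
          by simp
        then show ?thesis
          using ge1 by (rule order_trans)
      qed
    qed
    then show ?thesis
      using ge1 edge_only by (simp add: delta_lb_def Let_def max_def flip: m_def x_def)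
  qed
qed

end
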